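(* Let $n\ge 3$, let $A_0,A_1,A_2$ be real symmetric $n\times n$ matrices, and let $m_1,M_1,m_2,M_2\in\mathbb{R}$ with $m_1<M_1$ and $m_2\le M_2$. Assume that either there exist $s_0,s_1,s_2\in\mathbb{R}$ such that $s_0A_0+s_1A_1+s_2A_2\succ 0$, or the linear span of $\{A_0,A_1,A_2\}$ in the space of symmetric matrices has dimension less than $3$. Assume moreover the following Slater condition: - if $m_2<M_2$, there exists $\widetilde x\in\mathbb{R}^n$ with $m_1<\widetilde x^TA_1\widetilde x<M_1$ and $m_2<\widetilde x^TA_2\widetilde x<M_2$; - if $m_2=M_2$, there exist $\bar x,\bar x'\in\mathbb{R}^n$ with $m_1<\bar x^TA_1\bar x<M_1$, $\bar x^TA_2\bar x<m_2$, and $m_1<\bar x'^TA_1\bar x'<M_1$, $\bar x'^TA_2\bar x'>m_2$. Then strong duality holds for the quadratic optimization problem of minimizing $x^TA_0x$ over $x\in\mathbb{R}^n$ subject to $m_1\le x^TA_1x\le M_1$ and $m_2\le x^TA_2x\le M_2$; that is, its optimal value equals that of its Lagrangian dual: $$\inf\{x^TA_0x:\ x\in\mathbb{R}^n,\ m_1\le x^TA_1x\le M_1,\ m_2\le x^TA_2x\le M_2\}$$ $$=\ \sup\{\lambda_1m_1-\mu_1M_1+\lambda_2m_2-\mu_2M_2:\ \lambda_1,\mu_1,\lambda_2,\mu_2\ge 0,\ A_0+(\mu_1-\lambda_1)A_1+(\mu_2-\lambda_2)A_2\succeq 0\}.$$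
   Context: For a real symmetric matrix $A$, $A\succ 0$ (respectively $A\succeq 0$) means that $A$ is positive definite (respectively positive semidefinite). Optimal values are taken in the extended reals $[-\infty,+\infty]$, with the supremum over the empty set equal to $-\infty$. Strong duality means equality of the primal and dual optimal values. *)

theory Defs
  imports "HOL-Analysis.Analysis"
begin

definition symmetric_matrix :: "real ^ 'n ^ 'n \<Rightarrow> bool" where
  "symmetric_matrix A \<longleftrightarrow> transpose A = A"

definition quad_form :: "real ^ 'n ^ 'n \<Rightarrow> real ^ 'n \<Rightarrow> real" where
  "quad_form A x = x \<bullet> (A *v x)"

definition pos_def :: "real ^ 'n ^ 'n \<Rightarrow> bool" where
  "pos_def A \<longleftrightarrow> symmetric_matrix A \<and> (\<forall>x. x \<noteq> 0 \<longrightarrow> quad_form A x > 0)"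

definition pos_semidef :: "real ^ 'n ^ 'n \<Rightarrow> bool" where
  "pos_semidef A \<longleftrightarrow> symmetric_matrix A \<and> (\<forall>x. quad_form A x \<ge> 0)"

end

(*
  The set of value triples (x^T A0 x, x^T A1 x, x^T A2 x) is a convex cone K. When A0, A1, A2 are linearly
  dependent this is Dines' theorem for two forms, where a suitable point of the plane spanned by
  x and y is found by solving a quadratic equation. When some combination P is positive definite,
  restrict to the P-unit sphere: the image of a great circle under the other two forms is an ellipse,
  traversed twice. If a point inside the ellipse were missed by the whole sphere, a hemisphere
  bounded by that great circle (here n >= 3 is used) would give a nonvanishing map of the disc to
  the complex plane that equals z^2 + q with |q| < 1 on the unit circle; its continuous square root
  would contradict Brouwer's fixed point theorem.
  Strong duality follows by separating K from {r < v} x [m1, M1] x [m2, M2], where v is the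
  optimal value; the Slater condition makes the coefficient of the objective positive.
*)
theory Submission
  imports Defs
begin

section \<open>Algebra and continuity of quadratic forms\<close>

lemma quad_form_add:
  "quad_form (A + B) x = quad_form A x + quad_form B x"
  by (simp add: quad_form_def matrix_vector_mult_add_rdistrib inner_add_right)

lemma quad_form_scaleR_matrix: "quad_form (c *\<^sub>R A) x = c * quad_form A x"
  by (simp add: quad_form_def scaleR_matrix_vector_assoc[symmetric])

lemma quad_form_scaleR: "quad_form A (c *\<^sub>R x) = c\<^sup>2 * quad_form A x"
  by (simp add: quad_form_def matrix_vector_mult_scaleR power2_eq_square)

lemma quad_form_zero [simp]: "quad_form A 0 = 0"
  by (simp add: quad_form_def)

lemma symmetric_matrix_inner_commute:
  assumes "symmetric_matrix A"
  shows "x \<bullet> (A *v y) = y \<bullet> (A *v x)"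
  using assms by (metis symmetric_matrix_def dot_lmul_matrix inner_commute transpose_matrix_vector)

lemma quad_form_lincomb:
  assumes "symmetric_matrix A"
  shows "quad_form A (a *\<^sub>R x + b *\<^sub>R y) =
    a\<^sup>2 * quad_form A x + b\<^sup>2 * quad_form A y + 2 * a * b * (x \<bullet> (A *v y))"
  using symmetric_matrix_inner_commute[OF assms, of y x]
  by (simp add: quad_form_def matrix_vector_right_distrib matrix_vector_mult_scaleR
      inner_add_left inner_add_right power2_eq_square algebra_simps)

lemma continuous_on_quad_form [continuous_intros]:
  assumes "continuous_on S f"
  shows "continuous_on S (\<lambda>x. quad_form A (f x))"
  unfolding quad_form_def
  by (intro continuous_intros assms continuous_on_compose2[OF matrix_vector_mult_linear_continuous_on]) auto

section \<open>A zero theorem for maps of the disc\<close>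

text \<open>A zero-free \<open>F\<close> has a continuous square root \<open>g\<close> on the
  contractible disc. On the circle \<open>g z / z\<close> avoids the imaginary axis, so its real
  part has a constant sign \<open>s\<close> there. The disc map \<open>- s * sgn (g z)\<close> then
  has a Brouwer fixed point, at which that sign is wrong.\<close>

lemma disc_map_square_boundary_has_zero:
  fixes F :: "complex \<Rightarrow> complex"
  assumes contF: "continuous_on (cball 0 1) F"
    and bd: "\<And>z. norm z = 1 \<Longrightarrow> F z = z\<^sup>2 + q"
    and q: "norm q < 1"
  shows "\<exists>z\<in>cball 0 1. F z = 0"
proof (rule ccontr)
  assume "\<not> ?thesis"
  then have nz: "F z \<noteq> 0" if "z \<in> cball 0 1" for z using that by blast
  obtain g where contg: "continuous_on (cball 0 1) g" and g: "\<And>z. z \<in> cball 0 1 \<Longrightarrow> F z = (g z)\<^sup>2"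
    using continuous_sqrt_on_contractible[OF contF convex_imp_contractible[OF convex_cball] nz] by blast
  have Re_nz: "Re (g z / z) \<noteq> 0" if "z \<in> sphere 0 1" for z
  proof
    assume *: "Re (g z / z) = 0"
    have z: "norm z = 1" "z \<noteq> 0" using that by auto
    \<comment> \<open>This square lies within distance \<open>norm q < 1\<close> of 1, so its real
      part is positive, whereas the square of a purely imaginary number has real part at most
      0.\<close>
    have "(g z / z)\<^sup>2 = 1 + q / z\<^sup>2"
      using g[of z] bd[of z] z by (simp add: power_divide field_simps)
    moreover have "Re ((g z / z)\<^sup>2) \<le> 0" using * unfolding Re_power2 by simp
    moreover have "\<bar>Re (q / z\<^sup>2)\<bar> < 1"
      using abs_Re_le_cmod[of "q / z\<^sup>2"] q z by (simp add: norm_divide norm_power)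
    ultimately show False by simp
  qed
  let ?h = "\<lambda>z. Re (g z / z)"
  have "continuous_on (sphere 0 1) g"
    by (rule continuous_on_subset[OF contg]) auto
  then have "continuous_on (sphere 0 1) ?h"
    by (intro continuous_intros) auto
  moreover have "connected (sphere (0::complex) 1)"
    by (rule connected_sphere) simp
  ultimately have conn: "connected (?h ` sphere 0 1)"
    by (rule connected_continuous_image)
  have "(\<forall>z\<in>sphere 0 1. ?h z > 0) \<or> (\<forall>z\<in>sphere 0 1. ?h z < 0)"
  proof (rule ccontr)
    assume "\<not> ?thesis"
    then obtain y z where "y \<in> sphere 0 1" "z \<in> sphere 0 1" "?h y \<le> 0" "0 \<le> ?h z"
      by force
    then have "0 \<in> ?h ` sphere 0 1" using connectedD_interval[OF conn] by blast
    then show False using Re_nz by force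
  qed
  then obtain s :: real where s: "s = 1 \<or> s = -1" and pos: "\<And>z. norm z = 1 \<Longrightarrow> s * ?h z > 0"
    by (force intro: that[of 1] that[of "-1"])
  let ?r = "\<lambda>z. - (s *\<^sub>R sgn (g z))"
  have gnz: "g z \<noteq> 0" if "z \<in> cball 0 1" for z using g[OF that] nz[OF that] by auto
  obtain z where z: "z \<in> cball 0 1" "?r z = z"
  proof (rule brouwer[of "cball (0::complex) 1" ?r])
    show "continuous_on (cball 0 1) ?r"
      using gnz by (intro continuous_intros contg) auto
    show "?r \<in> cball 0 1 \<rightarrow> cball 0 1"
      using s by (auto simp: norm_sgn)
  qed auto
  have n: "norm z = 1" using z s gnz[OF z(1)] by (metis abs_1 abs_minus norm_minus_cancel norm_scaleR norm_sgn mult_1)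
  have zg: "z = - (s *\<^sub>R sgn (g z))" using z by simp
  \<comment> \<open>The fixed point equation makes \<open>g z\<close> a real multiple of
    \<open>z\<close>, with sign opposite to \<open>s\<close>.\<close>
  have "g z = - (s * norm (g z)) *\<^sub>R z"
    using s gnz[OF z(1)] by (subst zg) (auto simp: sgn_div_norm)
  then have "g z / z = of_real (- (s * norm (g z)))"
    using n by (metis nonzero_mult_div_cancel_right norm_zero scaleR_conv_of_real zero_neq_one)
  then have "s * ?h z = - (s * s * norm (g z))" by (simp)
  then show False using pos[OF n] s by auto
qed


section \<open>Joint range when one form is positive definite\<close>

text \<open>Gram-Schmidt for the inner product defined by \<open>P\<close>: \<open>w\<close> is the
  component of \<open>y\<close> that is P-orthogonal to \<open>x\<close>.\<close>

lemma pos_def_orthonormal_pair: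
  assumes P: "pos_def P" and y: "\<And>c. y \<noteq> c *\<^sub>R x" and x: "x \<noteq> 0"
  obtains u v a b c where "quad_form P u = 1" "quad_form P v = 1" "u \<bullet> (P *v v) = 0"
    "x = a *\<^sub>R u" "y = b *\<^sub>R u + c *\<^sub>R v"
proof -
  have pos: "\<And>x. x \<noteq> 0 \<Longrightarrow> quad_form P x > 0"
    using P by (auto simp: pos_def_def)
  define k where "k = (x \<bullet> (P *v y)) / quad_form P x"
  define w where "w = y - k *\<^sub>R x"
  define r where "r = sqrt (quad_form P x)"
  define t where "t = sqrt (quad_form P w)"
  have "w \<noteq> 0" using y[of k] by (auto simp: w_def)
  have r: "r > 0" "r\<^sup>2 = quad_form P x" using pos[OF x] by (auto simp: r_def)
  have t: "t > 0" "t\<^sup>2 = quad_form P w" using pos[OF \<open>w \<noteq> 0\<close>] by (auto simp: t_def)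
  have xw: "x \<bullet> (P *v w) = 0"
    using pos[OF x]
    by (simp add: w_def k_def matrix_vector_mult_diff_distrib matrix_vector_mult_scaleR
        inner_diff_right quad_form_def)
  show ?thesis
  proof (rule that[of "(1/r) *\<^sub>R x" "(1/t) *\<^sub>R w" r "k * r" t])
    show "quad_form P ((1/r) *\<^sub>R x) = 1" "quad_form P ((1/t) *\<^sub>R w) = 1"
      using r t by (simp_all only: quad_form_scaleR) (simp_all add: power_divide flip: r(2) t(2))
    show "((1/r) *\<^sub>R x) \<bullet> (P *v ((1/t) *\<^sub>R w)) = 0"
      by (simp add: matrix_vector_mult_scaleR xw)
  qed (use r t in \<open>simp_all add: w_def\<close>)
qed

text \<open>The vectors \<open>P *v u\<close> and \<open>P *v v\<close> span at most a plane, so in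
  dimension at least 3 some nonzero vector is orthogonal to both; it only remains to normalise
  it.\<close>

lemma pos_def_third_vector:
  fixes P :: "real ^ 'n ^ 'n"
  assumes "CARD('n) \<ge> 3" and P: "pos_def P"
  obtains w where "quad_form P w = 1" "u \<bullet> (P *v w) = 0" "v \<bullet> (P *v w) = 0"
proof -
  have sym: "symmetric_matrix P" and pos: "\<And>x. x \<noteq> 0 \<Longrightarrow> quad_form P x > 0"
    using P by (auto simp: pos_def_def)
  let ?S = "{P *v u, P *v v}"
  have "dim (span ?S) \<le> card ?S" by (simp add: dim_le_card')
  also have "\<dots> \<le> 2" by (simp add: card_insert_if)
  also have "2 < DIM(real^'n)" using assms by simp
  finally obtain y where y: "y \<noteq> 0" "\<And>x. x \<in> span ?S \<Longrightarrow> orthogonal y x"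
    using orthogonal_to_subspace_exists[of ?S] by (metis dim_span)
  have orth: "u \<bullet> (P *v y) = 0" "v \<bullet> (P *v y) = 0"
    using y(2)[of "P *v u"] y(2)[of "P *v v"] symmetric_matrix_inner_commute[OF sym, of y]
    by (auto simp: orthogonal_def span_base)
  define t where "t = sqrt (quad_form P y)"
  have t: "t > 0" "t\<^sup>2 = quad_form P y" using pos[OF y(1)] by (auto simp: t_def)
  show ?thesis
  proof (rule that[of "(1/t) *\<^sub>R y"])
    show "quad_form P ((1/t) *\<^sub>R y) = 1"
      using t by (simp only: quad_form_scaleR) (simp add: power_divide flip: t(2))
  qed (simp_all add: matrix_vector_mult_scaleR orth)
qed

lemma circle_half_angle:
  fixes a b :: real
  assumes "a\<^sup>2 + b\<^sup>2 = 1"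
  obtains s t where "s\<^sup>2 + t\<^sup>2 = 1" "s\<^sup>2 - t\<^sup>2 = a" "2 * s * t = b"
proof -
  obtain \<theta> where "a = cos \<theta>" "b = sin \<theta>" using sincos_total_2pi[OF assms] by metis
  then have "a = cos (2 * (\<theta>/2))" "b = sin (2 * (\<theta>/2))" by simp_all
  then show ?thesis
    by (intro that[of "cos (\<theta>/2)" "sin (\<theta>/2)"]) (simp_all only: cos_double sin_double, simp_all)
qed

text \<open>A line through a point of the closed disc meets the unit circle: the equation is
  quadratic in \<open>t\<close>, with a quarter of its discriminant equal to \<open>D\<close>, which
  is nonnegative because the point lies in the disc.\<close>

lemma segment_reaches_circle:
  fixes a b d e :: real
  assumes "a\<^sup>2 + b\<^sup>2 \<le> 1" and "d \<noteq> 0 \<or> e \<noteq> 0"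
  obtains t where "(a + t * d)\<^sup>2 + (b + t * e)\<^sup>2 = 1"
proof -
  let ?f = "\<lambda>t. (a + t * d)\<^sup>2 + (b + t * e)\<^sup>2"
  define n where "n = d\<^sup>2 + e\<^sup>2"
  have n: "n > 0" using assms(2) by (auto simp: n_def add_pos_nonneg add_nonneg_pos)
  define k where "k = a * d + b * e"
  define D where "D = k\<^sup>2 + n * (1 - a\<^sup>2 - b\<^sup>2)"
  have "D \<ge> 0" using n assms by (simp add: D_def)
  define t where "t = (sqrt D - k) / n"
  have "n * t + k = sqrt D" using n by (simp add: t_def)
  then have "(n * t + k)\<^sup>2 = D" using \<open>D \<ge> 0\<close> by simp
  then have "n * (n * t\<^sup>2 + 2 * k * t) = n * (1 - a\<^sup>2 - b\<^sup>2)"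
    by (simp add: D_def power2_eq_square algebra_simps)
  then have "n * t\<^sup>2 + 2 * k * t = 1 - a\<^sup>2 - b\<^sup>2" using n by simp
  then have "?f t = 1" by (simp add: n_def k_def power2_eq_square algebra_simps)
  then show ?thesis using that by blast
qed

text \<open>On the great circle of points \<open>s *\<^sub>R u + t *\<^sub>R v\<close> the pair of
  values runs through an ellipse, with parameters \<open>s\<^sup>2 - t\<^sup>2\<close> and
  \<open>2 * s * t\<close>. With \<open>(a, b)\<close> in the closed disc, the right-hand sides
  describe the filled ellipse, so the claim is that the sphere's image contains it.\<close>

lemma disc_in_sphere_image:
  fixes P :: "real ^ 'n ^ 'n"
  assumes card: "CARD('n) \<ge> 3" and P: "pos_def P"
    and sym: "symmetric_matrix F" "symmetric_matrix G"
    and uv: "quad_form P u = 1" "quad_form P v = 1" "u \<bullet> (P *v v) = 0"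
    and ab: "a\<^sup>2 + b\<^sup>2 \<le> 1"
  shows "\<exists>z. quad_form P z = 1 \<and>
    quad_form F z = (quad_form F u + quad_form F v) / 2 + a * ((quad_form F u - quad_form F v) / 2)
      + b * (u \<bullet> (F *v v)) \<and>
    quad_form G z = (quad_form G u + quad_form G v) / 2 + a * ((quad_form G u - quad_form G v) / 2)
      + b * (u \<bullet> (G *v v))"
proof -
  have symP: "symmetric_matrix P" using P by (simp add: pos_def_def)
  define c1 c2 where "c1 = (quad_form F u + quad_form F v) / 2" and "c2 = (quad_form G u + quad_form G v) / 2"
  define \<alpha>1 \<alpha>2 where "\<alpha>1 = (quad_form F u - quad_form F v) / 2" and "\<alpha>2 = (quad_form G u - quad_form G v) / 2"
  define \<beta>1 \<beta>2 where "\<beta>1 = u \<bullet> (F *v v)" and "\<beta>2 = u \<bullet> (G *v v)"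
  note defs = c1_def c2_def \<alpha>1_def \<alpha>2_def \<beta>1_def \<beta>2_def
  have onF: "quad_form F (s *\<^sub>R u + t *\<^sub>R v) = c1 * (s\<^sup>2 + t\<^sup>2) + (s\<^sup>2 - t\<^sup>2) * \<alpha>1 + 2 * s * t * \<beta>1" for s t
    by (simp add: quad_form_lincomb[OF sym(1)] defs field_simps)
  have onG: "quad_form G (s *\<^sub>R u + t *\<^sub>R v) = c2 * (s\<^sup>2 + t\<^sup>2) + (s\<^sup>2 - t\<^sup>2) * \<alpha>2 + 2 * s * t * \<beta>2" for s t
    by (simp add: quad_form_lincomb[OF sym(2)] defs field_simps)
  have onP: "quad_form P (s *\<^sub>R u + t *\<^sub>R v) = s\<^sup>2 + t\<^sup>2" for s t
    by (simp add: quad_form_lincomb[OF symP] uv)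
  have "\<exists>z. quad_form P z = 1 \<and> quad_form F z = c1 + a * \<alpha>1 + b * \<beta>1 \<and> quad_form G z = c2 + a * \<alpha>2 + b * \<beta>2"
  proof (cases "\<alpha>1 * \<beta>2 - \<alpha>2 * \<beta>1 = 0")
    \<comment> \<open>Degenerate ellipse: moving \<open>(a, b)\<close> along a kernel direction
      \<open>(d, e)\<close> leaves the values unchanged, so the parameter can be slid to the unit
      circle, where halving the angle gives a point of the great circle.\<close>
    case True
    have "\<exists>d e. (d \<noteq> 0 \<or> e \<noteq> 0) \<and> d * \<alpha>1 + e * \<beta>1 = 0 \<and> d * \<alpha>2 + e * \<beta>2 = 0"
    proof (cases "\<alpha>1 = 0 \<and> \<beta>1 = 0")
      case True
      show ?thesis
      proof (cases "\<alpha>2 = 0 \<and> \<beta>2 = 0")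
        case True
        then show ?thesis using \<open>\<alpha>1 = 0 \<and> \<beta>1 = 0\<close> by (intro exI[of _ 1]) auto
      next
        case False
        then show ?thesis using True by (intro exI[of _ "\<beta>2"] exI[of _ "-\<alpha>2"]) auto
      qed
    next
      case False
      then show ?thesis using True by (intro exI[of _ "\<beta>1"] exI[of _ "-\<alpha>1"]) (auto simp: algebra_simps)
    qed
    then obtain d e where de: "d \<noteq> 0 \<or> e \<noteq> 0" "d * \<alpha>1 + e * \<beta>1 = 0" "d * \<alpha>2 + e * \<beta>2 = 0"
      by blast
    obtain r where r: "(a + r * d)\<^sup>2 + (b + r * e)\<^sup>2 = 1"
      using segment_reaches_circle[OF ab de(1)] .
    obtain s t where st: "s\<^sup>2 + t\<^sup>2 = 1" "s\<^sup>2 - t\<^sup>2 = a + r * d" "2 * s * t = b + r * e"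
      using circle_half_angle[OF r] .
    have "(a + r * d) * \<alpha>1 + (b + r * e) * \<beta>1 = a * \<alpha>1 + b * \<beta>1 + r * (d * \<alpha>1 + e * \<beta>1)"
      "(a + r * d) * \<alpha>2 + (b + r * e) * \<beta>2 = a * \<alpha>2 + b * \<beta>2 + r * (d * \<alpha>2 + e * \<beta>2)"
      by (simp_all add: algebra_simps)
    then show ?thesis
      by (intro exI[of _ "s *\<^sub>R u + t *\<^sub>R v"]) (simp add: onP onF onG st de)
  next
    case False
    define D where "D = \<alpha>1 * \<beta>2 - \<alpha>2 * \<beta>1"
    have D: "D \<noteq> 0" using False by (simp add: D_def)
    show ?thesis
    proof (cases "a\<^sup>2 + b\<^sup>2 = 1")
      case True
      then obtain s t where "s\<^sup>2 + t\<^sup>2 = 1" "s\<^sup>2 - t\<^sup>2 = a" "2 * s * t = b"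
        using circle_half_angle by blast
      then show ?thesis
        by (intro exI[of _ "s *\<^sub>R u + t *\<^sub>R v"]) (simp add: onP onF onG)
    next
      case False
      obtain w where w: "quad_form P w = 1" "u \<bullet> (P *v w) = 0" "v \<bullet> (P *v w) = 0"
        using pos_def_third_vector[OF card P] .
      \<comment> \<open>\<open>Z\<close> lifts the disc to the P-unit hemisphere with pole
        \<open>w\<close>; on the boundary it parametrises the great circle.\<close>
      define Z where "Z = (\<lambda>\<zeta>. (Re \<zeta> *\<^sub>R u + Im \<zeta> *\<^sub>R v) + sqrt (1 - (norm \<zeta>)\<^sup>2) *\<^sub>R w)"
      define X where "X = (\<lambda>\<zeta>. quad_form F (Z \<zeta>) - (c1 + a * \<alpha>1 + b * \<beta>1))"
      define Y where "Y = (\<lambda>\<zeta>. quad_form G (Z \<zeta>) - (c2 + a * \<alpha>2 + b * \<beta>2))"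
      \<comment> \<open>Cramer's rule: \<open>H\<close> gives the coordinates of the deviation
        \<open>(X, Y)\<close> from the target in the basis \<open>(\<alpha>1, \<alpha>2)\<close>,
        \<open>(\<beta>1, \<beta>2)\<close>. A zero of \<open>H\<close> is thus a point hitting the
        target, and on the circle \<open>H\<close> is squaring shifted by a constant.\<close>
      define H where "H = (\<lambda>\<zeta>. Complex ((\<beta>2 * X \<zeta> - \<beta>1 * Y \<zeta>) / D) ((\<alpha>1 * Y \<zeta> - \<alpha>2 * X \<zeta>) / D))"
      have PZ: "quad_form P (Z \<zeta>) = 1" if "\<zeta> \<in> cball 0 1" for \<zeta>
      proof -
        have "0 \<le> 1 - (norm \<zeta>)\<^sup>2" using that by (simp add: power_le_one)
        moreover have "quad_form P (Z \<zeta>) =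
            quad_form P (Re \<zeta> *\<^sub>R u + Im \<zeta> *\<^sub>R v) + (sqrt (1 - (norm \<zeta>)\<^sup>2))\<^sup>2"
          using quad_form_lincomb[OF symP, of 1 "Re \<zeta> *\<^sub>R u + Im \<zeta> *\<^sub>R v"]
          by (simp add: Z_def w inner_add_left)
        ultimately show ?thesis by (simp add: onP cmod_def)
      qed
      have "\<exists>\<zeta>\<in>cball 0 1. H \<zeta> = 0"
      proof (rule disc_map_square_boundary_has_zero)
        show "continuous_on (cball 0 1) H"
          unfolding H_def X_def Y_def Z_def by (intro continuous_intros) (use D in auto)
        show "H \<zeta> = \<zeta>\<^sup>2 + (- Complex a b)" if "norm \<zeta> = 1" for \<zeta>
        proof -
          have sq: "(Re \<zeta>)\<^sup>2 + (Im \<zeta>)\<^sup>2 = 1" using that by (simp add: cmod_def)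
          have Z: "Z \<zeta> = Re \<zeta> *\<^sub>R u + Im \<zeta> *\<^sub>R v" using that by (simp add: Z_def)
          define p where "p = (Re \<zeta>)\<^sup>2 - (Im \<zeta>)\<^sup>2 - a"
          define q where "q = 2 * Re \<zeta> * Im \<zeta> - b"
          have X: "X \<zeta> = p * \<alpha>1 + q * \<beta>1" and Y: "Y \<zeta> = p * \<alpha>2 + q * \<beta>2"
            by (simp_all add: X_def Y_def Z onF onG sq p_def q_def left_diff_distrib)
          have "\<beta>2 * X \<zeta> - \<beta>1 * Y \<zeta> = D * p" "\<alpha>1 * Y \<zeta> - \<alpha>2 * X \<zeta> = D * q"
            by (simp_all add: X Y D_def algebra_simps)
          then have "H \<zeta> = Complex p q" using D by (simp add: H_def)
          then show ?thesis by (simp add: complex_eq_iff Re_power2 Im_power2 p_def q_def)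
        qed
        show "norm (- Complex a b) < 1" using ab False by (simp add: cmod_def)
      qed
      then obtain \<zeta> where \<zeta>: "\<zeta> \<in> cball 0 1" "H \<zeta> = 0" by blast
      then have eq: "\<beta>2 * X \<zeta> - \<beta>1 * Y \<zeta> = 0" "\<alpha>1 * Y \<zeta> - \<alpha>2 * X \<zeta> = 0"
        using D by (simp_all add: H_def complex_eq_iff)
      have "D * X \<zeta> = \<alpha>1 * (\<beta>2 * X \<zeta> - \<beta>1 * Y \<zeta>) + \<beta>1 * (\<alpha>1 * Y \<zeta> - \<alpha>2 * X \<zeta>)"
        "D * Y \<zeta> = \<alpha>2 * (\<beta>2 * X \<zeta> - \<beta>1 * Y \<zeta>) + \<beta>2 * (\<alpha>1 * Y \<zeta> - \<alpha>2 * X \<zeta>)"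
        by (simp_all add: D_def algebra_simps)
      then have "X \<zeta> = 0" "Y \<zeta> = 0" unfolding eq using D by simp_all
      then show ?thesis using PZ[OF \<zeta>(1)] by (intro exI[of _ "Z \<zeta>"]) (simp add: X_def Y_def)
    qed
  qed
  then show ?thesis by (simp add: defs)
qed


text \<open>For non-parallel \<open>x\<close> and \<open>y\<close>, dividing the summed values by
  \<open>n\<close>, the sum of the two P-values, gives a point of the filled ellipse of
  \<open>u\<close> and \<open>v\<close>. A unit vector \<open>z\<close> realises it, and scaling by
  \<open>sqrt n\<close> undoes the division.\<close>

lemma pos_def_joint_range_add:
  fixes P :: "real ^ 'n ^ 'n"
  assumes card: "CARD('n) \<ge> 3" and P: "pos_def P"
    and sym: "symmetric_matrix F" "symmetric_matrix G"
  shows "\<exists>z. quad_form P z = quad_form P x + quad_form P y \<and>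
    quad_form F z = quad_form F x + quad_form F y \<and>
    quad_form G z = quad_form G x + quad_form G y"
proof -
  have symP: "symmetric_matrix P" using P by (simp add: pos_def_def)
  consider "x = 0" | c where "y = c *\<^sub>R x" | "x \<noteq> 0" "\<And>c. y \<noteq> c *\<^sub>R x" by blast
  then show ?thesis
  proof cases
    case 1
    then show ?thesis by (intro exI[of _ y]) simp
  next
    case 2
    then show ?thesis
      by (intro exI[of _ "sqrt (1 + c\<^sup>2) *\<^sub>R x"]) (simp add: quad_form_scaleR algebra_simps)
  next
    case 3
    obtain u v a b c where uv: "quad_form P u = 1" "quad_form P v = 1" "u \<bullet> (P *v v) = 0"
      and x: "x = a *\<^sub>R u" and y: "y = b *\<^sub>R u + c *\<^sub>R v"
      using pos_def_orthonormal_pair[OF P 3(2,1)] by metis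
    define n where "n = a\<^sup>2 + b\<^sup>2 + c\<^sup>2"
    have "a \<noteq> 0" using x 3(1) by auto
    then have n: "n > 0" by (simp add: n_def add_pos_nonneg)
    \<comment> \<open>The sum has coefficients \<open>a\<^sup>2 + b\<^sup>2\<close> on
      \<open>u\<close>, \<open>c\<^sup>2\<close> on \<open>v\<close> and \<open>2 * b * c\<close> on
      the mixed term; \<open>p\<close> and \<open>q\<close> are the disc parameters matching these
      after division by \<open>n\<close>.\<close>
    define p where "p = (a\<^sup>2 + b\<^sup>2 - c\<^sup>2) / n"
    define q where "q = 2 * b * c / n"
    have np: "n * p = a\<^sup>2 + b\<^sup>2 - c\<^sup>2" "n * q = 2 * b * c" using n by (simp_all add: p_def q_def)
    have "(n * p)\<^sup>2 + (n * q)\<^sup>2 + (2 * a * c)\<^sup>2 = n\<^sup>2"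
      unfolding np by (simp add: n_def power2_eq_square algebra_simps)
    then have "n\<^sup>2 * (p\<^sup>2 + q\<^sup>2) \<le> n\<^sup>2 * 1"
      using zero_le_power2[of "2 * a * c"] unfolding power_mult_distrib[of n] distrib_left by linarith
    then have "p\<^sup>2 + q\<^sup>2 \<le> 1" using n by simp
    then obtain z where z: "quad_form P z = 1"
      "quad_form F z = (quad_form F u + quad_form F v) / 2 + p * ((quad_form F u - quad_form F v) / 2)
        + q * (u \<bullet> (F *v v))"
      "quad_form G z = (quad_form G u + quad_form G v) / 2 + p * ((quad_form G u - quad_form G v) / 2)
        + q * (u \<bullet> (G *v v))"
      using disc_in_sphere_image[OF card P sym uv] by blast
    have scaled: "n * ((g + h) / 2 + p * ((g - h) / 2) + q * m) = a\<^sup>2 * g + (b\<^sup>2 * g + c\<^sup>2 * h + 2 * b * c * m)"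
      for g h m
    proof -
      have "n * ((g + h) / 2 + p * ((g - h) / 2) + q * m) =
          n * ((g + h) / 2) + (n * p) * ((g - h) / 2) + (n * q) * m"
        by (simp add: algebra_simps)
      then show ?thesis unfolding np by (simp add: n_def field_simps)
    qed
    show ?thesis
    proof (intro exI conjI)
      let ?z = "sqrt n *\<^sub>R z"
      show "quad_form P ?z = quad_form P x + quad_form P y"
        using n by (simp add: x y quad_form_scaleR quad_form_lincomb[OF symP] uv z(1) n_def)
      show "quad_form F ?z = quad_form F x + quad_form F y" "quad_form G ?z = quad_form G x + quad_form G y"
        unfolding x y quad_form_scaleR quad_form_lincomb[OF sym(1)] quad_form_lincomb[OF sym(2)] z(2,3)
        using n by (simp_all only: scaled real_sqrt_pow2 less_imp_le)
    qed
  qed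
qed

section \<open>Dines' theorem and the combined joint range\<close>

text \<open>It suffices to find a vector whose two values are a common positive multiple of the
  required sums, since rescaling finishes. If the value pairs of \<open>x\<close> and
  \<open>y\<close> are independent, such a vector exists of the form
  \<open>a *\<^sub>R x + y\<close>.\<close>

lemma Dines_joint_range_add:
  assumes sym: "symmetric_matrix F" "symmetric_matrix G"
  shows "\<exists>z. quad_form F z = quad_form F x + quad_form F y \<and>
    quad_form G z = quad_form G x + quad_form G y"
proof -
  define fx fy m where "fx = quad_form F x" and "fy = quad_form F y" and "m = x \<bullet> (F *v y)"
  define gx gy n where "gx = quad_form G x" and "gy = quad_form G y" and "n = x \<bullet> (G *v y)"
  note defs = fx_def fy_def gx_def gy_def
  define D where "D = fx * gy - gx * fy"
  have "\<exists>z. quad_form F z = fx + fy \<and> quad_form G z = gx + gy"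
  proof (cases "D = 0")
    case True
    consider "fx = 0" "gx = 0" | l where "fy = l * fx" "gy = l * gx"
    proof (cases "fx = 0")
      case fx: True
      show ?thesis
      proof (cases "gx = 0")
        case False
        then show ?thesis using True fx that(2)[of "gy / gx"] by (auto simp: D_def)
      qed (use fx that in blast)
    next
      case False
      then show ?thesis using True that(2)[of "fy / fx"] by (auto simp: D_def field_simps)
    qed
    then show ?thesis
    proof cases
      case 1
      then show ?thesis by (intro exI[of _ y]) (simp add: defs)
    next
      case 2
      show ?thesis
      proof (cases "1 + l \<ge> 0")
        case True
        then show ?thesis using 2
          by (intro exI[of _ "sqrt (1 + l) *\<^sub>R x"]) (simp add: quad_form_scaleR defs algebra_simps)
      next
        \<comment> \<open>Here \<open>l < -1\<close>, so no multiple of \<open>x\<close> will do in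
          general; measured against \<open>y\<close> the factor is \<open>1 + 1 / l\<close>, which
          is nonnegative.\<close>
        case False
        then have l: "l < 0" "1 + 1 / l \<ge> 0" by (simp_all add: field_simps)
        have "(1 + 1 / l) * fy = fx + fy" "(1 + 1 / l) * gy = gx + gy"
          using l(1) by (simp_all add: 2 field_simps)
        then show ?thesis using l
          by (intro exI[of _ "sqrt (1 + 1 / l) *\<^sub>R y"]) (simp add: quad_form_scaleR defs)
      qed
    qed
  next
    case False
    \<comment> \<open>By Cramer's rule, \<open>e1\<close> and \<open>e2\<close> are the coordinates
      of the mixed terms \<open>(m, n)\<close> in the basis \<open>(fx, gx)\<close>,
      \<open>(fy, gy)\<close>.\<close>
    define e1 where "e1 = (m * gy - n * fy) / D"
    define e2 where "e2 = (fx * n - gx * m) / D"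
    have "D * e1 = m * gy - n * fy" "D * e2 = fx * n - gx * m"
      using False by (simp_all add: e1_def e2_def)
    then have "D * (e1 * fx + e2 * fy) = D * m" "D * (e1 * gx + e2 * gy) = D * n"
      by (simp_all add: distrib_left flip: mult.assoc) (simp_all add: D_def algebra_simps)
    then have mn: "m = e1 * fx + e2 * fy" "n = e1 * gx + e2 * gy"
      using False by simp_all
    \<comment> \<open>The values at \<open>a *\<^sub>R x + y\<close> have coefficients
      \<open>a\<^sup>2 + 2 * a * e1\<close> and \<open>1 + 2 * a * e2\<close> in that basis. They
      agree when \<open>a\<^sup>2 - 2 * e * a - 1 = 0\<close>, whose roots have opposite signs;
      \<open>s\<close> selects the root with \<open>a * (e1 + e2) \<ge> 0\<close>.\<close>
    define e where "e = e2 - e1"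
    define s :: real where "s = (if e1 + e2 \<ge> 0 then 1 else -1)"
    define a where "a = e + s * sqrt (e\<^sup>2 + 1)"
    have "(a - e)\<^sup>2 = e\<^sup>2 + 1"
      by (simp add: a_def power_mult_distrib s_def)
    then have quad: "a\<^sup>2 + 2 * a * e1 = 1 + 2 * a * e2"
      by (simp add: e_def power2_eq_square algebra_simps)
    have "\<bar>e\<bar> < sqrt (e\<^sup>2 + 1)" by (simp add: real_less_rsqrt)
    then have "a * (e1 + e2) \<ge> 0"
      by (auto simp: a_def s_def intro: mult_nonneg_nonneg mult_nonpos_nonpos)
    define k where "k = 1 + 2 * a * e2"
    \<comment> \<open>Adding the two equal coefficients shows that their common value
      \<open>k\<close> is positive.\<close>
    have "2 * k = a\<^sup>2 + 1 + 2 * (a * (e1 + e2))" using quad by (simp add: k_def algebra_simps)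
    then have k: "k > 0" using \<open>a * (e1 + e2) \<ge> 0\<close> zero_le_power2[of a] by linarith
    have eval: "a\<^sup>2 * hx + hy + 2 * a * (e1 * hx + e2 * hy) = k * (hx + hy)" for hx hy
    proof -
      have "a\<^sup>2 * hx + hy + 2 * a * (e1 * hx + e2 * hy) =
          (a\<^sup>2 + 2 * a * e1) * hx + (1 + 2 * a * e2) * hy"
        by (simp add: algebra_simps)
      then show ?thesis unfolding quad by (simp only: k_def distrib_left)
    qed
    have "quad_form F (a *\<^sub>R x + 1 *\<^sub>R y) = k * (fx + fy)" "quad_form G (a *\<^sub>R x + 1 *\<^sub>R y) = k * (gx + gy)"
      unfolding quad_form_lincomb[OF sym(1)] quad_form_lincomb[OF sym(2)]
      using eval[of fx fy] eval[of gx gy] mn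
      by (simp_all add: defs m_def n_def)
    then show ?thesis using k
      by (intro exI[of _ "(1 / sqrt k) *\<^sub>R (a *\<^sub>R x + 1 *\<^sub>R y)"])
        (simp only: quad_form_scaleR, simp add: power_divide)
  qed
  then show ?thesis by (simp add: defs)
qed

text \<open>Adjoining \<open>C\<close>, \<open>B\<close>, \<open>A\<close> in turn, the first vector
  in the span of its predecessors yields the relation. This also covers coinciding vectors, where
  the set has fewer than three elements.\<close>

lemma dim_span_triple_less_3_imp_relation:
  fixes A B C :: "'a::euclidean_space"
  assumes "dim (span {A, B, C}) < 3"
  shows "\<exists>a b c. (a \<noteq> 0 \<or> b \<noteq> 0 \<or> c \<noteq> 0) \<and> a *\<^sub>R A + b *\<^sub>R B + c *\<^sub>R C = 0"
proof -
  consider "C = 0" | "C \<noteq> 0" "B \<in> span {C}" | "C \<noteq> 0" "B \<notin> span {C}" "A \<in> span {B, C}"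
    | "C \<noteq> 0" "B \<notin> span {C}" "A \<notin> span {B, C}" by blast
  then show ?thesis
  proof cases
    case 1
    then show ?thesis by (intro exI[of _ 0] exI[of _ 1]) simp
  next
    case 2
    then obtain k where "B - k *\<^sub>R C = 0" by (auto simp: span_breakdown_eq)
    then show ?thesis by (intro exI[of _ 0] exI[of _ 1] exI[of _ "-k"]) simp
  next
    case 3
    then obtain j k where "A - j *\<^sub>R B - k *\<^sub>R C = 0" by (auto simp: span_breakdown_eq)
    then show ?thesis by (intro exI[of _ 1] exI[of _ "-j"] exI[of _ "-k"]) (simp add: algebra_simps)
  next
    case 4
    then have "independent {A, B, C}" by (simp add: independent_insert)
    moreover have "card {A, B, C} = 3"
      using 4 span_base[of A "{B, C}"] span_base[of B "{C}"] by (auto simp: card_insert_if)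
    ultimately have "dim (span {A, B, C}) = 3" using dim_eq_card_independent by (metis dim_span)
    then show ?thesis using assms by simp
  qed
qed

text \<open>Both alternatives give a combination \<open>P\<close>, positive definite or zero, with a
  nonzero coefficient. The form carrying that coefficient can be exchanged for \<open>P\<close> and
  recovered linearly afterwards; for \<open>P = 0\<close> the other two forms fall under Dines'
  theorem.\<close>

lemma joint_range_add:
  fixes A B C :: "real ^ 'n ^ 'n"
  assumes card: "CARD('n) \<ge> 3"
    and sym: "symmetric_matrix A" "symmetric_matrix B" "symmetric_matrix C"
    and cases: "(\<exists>a b c. pos_def (a *\<^sub>R A + b *\<^sub>R B + c *\<^sub>R C)) \<or> dim (span {A, B, C}) < 3"
  shows "\<exists>z. quad_form A z = quad_form A x + quad_form A y \<and>
    quad_form B z = quad_form B x + quad_form B y \<and>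
    quad_form C z = quad_form C x + quad_form C y"
proof -
  obtain a b c where rel: "pos_def (a *\<^sub>R A + b *\<^sub>R B + c *\<^sub>R C) \<or> a *\<^sub>R A + b *\<^sub>R B + c *\<^sub>R C = 0"
    and nz: "a \<noteq> 0 \<or> b \<noteq> 0 \<or> c \<noteq> 0"
  proof (use cases in \<open>elim disjE exE\<close>)
    fix a b c assume pd: "pos_def (a *\<^sub>R A + b *\<^sub>R B + c *\<^sub>R C)"
    have "\<not> pos_def (0 :: real ^ 'n ^ 'n)"
      by (auto simp: pos_def_def quad_form_def intro!: exI[of _ 1])
    with pd have "a \<noteq> 0 \<or> b \<noteq> 0 \<or> c \<noteq> 0" by auto
    with pd show thesis using that by blast
  qed (use dim_span_triple_less_3_imp_relation that in blast)
  have key: "\<exists>z. quad_form A z = quad_form A x + quad_form A y \<and>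
      quad_form B z = quad_form B x + quad_form B y \<and>
      quad_form C z = quad_form C x + quad_form C y"
    if "symmetric_matrix B" "symmetric_matrix C" "a \<noteq> 0"
      and rel: "pos_def (a *\<^sub>R A + b *\<^sub>R B + c *\<^sub>R C) \<or> a *\<^sub>R A + b *\<^sub>R B + c *\<^sub>R C = 0"
    for A B C :: "real ^ 'n ^ 'n" and a b c
  proof -
    define P where "P = a *\<^sub>R A + b *\<^sub>R B + c *\<^sub>R C"
    have P: "a * quad_form A z = quad_form P z - b * quad_form B z - c * quad_form C z" for z
      by (simp add: P_def quad_form_add quad_form_scaleR_matrix)
    have "\<exists>z. quad_form P z = quad_form P x + quad_form P y \<and>
      quad_form B z = quad_form B x + quad_form B y \<and>
      quad_form C z = quad_form C x + quad_form C y"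
      using rel[folded P_def]
    proof
      assume "P = 0"
      then show ?thesis using Dines_joint_range_add[OF that(1,2)] by (simp add: quad_form_def)
    qed (rule pos_def_joint_range_add[OF card _ that(1,2)])
    then obtain z where z: "quad_form P z = quad_form P x + quad_form P y"
      "quad_form B z = quad_form B x + quad_form B y"
      "quad_form C z = quad_form C x + quad_form C y" by blast
    have "a * quad_form A z = a * (quad_form A x + quad_form A y)"
      unfolding distrib_left P z by (simp add: algebra_simps)
    then show ?thesis using z \<open>a \<noteq> 0\<close> by auto
  qed
  show ?thesis
    using nz
  proof (elim disjE)
    assume "a \<noteq> 0"
    then show ?thesis using key[OF sym(2,3) _ rel] by blast
  next
    assume "b \<noteq> 0"
    then show ?thesis using key[OF sym(1,3), of b B a c] rel by (auto simp: add_ac)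
  next
    assume "c \<noteq> 0"
    then show ?thesis using key[OF sym(1,2), of c C a b] rel by (auto simp: add_ac)
  qed
qed

section \<open>Separation and Lagrange multipliers\<close>

text \<open>A hyperplane separates the convex cone \<open>K\<close> of value triples from the box
  \<open>G\<close> of triples with objective below \<open>v\<close>. Its objective coefficient
  \<open>r0\<close> is positive, and dividing by it gives the multipliers.\<close>

lemma multiplier_of_convex_cone:
  fixes f0 f1 f2 :: "'a \<Rightarrow> real"
  assumes comb: "\<And>s t x y. s \<ge> 0 \<Longrightarrow> t \<ge> 0 \<Longrightarrow>
      \<exists>z. f0 z = s * f0 x + t * f0 y \<and> f1 z = s * f1 x + t * f1 y \<and> f2 z = s * f2 x + t * f2 y"
    and bounds: "m1 < M1" "m2 \<le> M2"
    and inner: "m1 < f1 w" "f1 w < M1" "m2 \<le> f2 w" "f2 w \<le> M2"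
    and slater: "m2 < M2 \<Longrightarrow> \<exists>x. m2 < f2 x \<and> f2 x < M2"
      "m2 = M2 \<Longrightarrow> \<exists>x y. f2 x < m2 \<and> m2 < f2 y"
    and lower: "\<And>x. m1 \<le> f1 x \<Longrightarrow> f1 x \<le> M1 \<Longrightarrow> m2 \<le> f2 x \<Longrightarrow> f2 x \<le> M2 \<Longrightarrow> v \<le> f0 x"
  obtains r1 r2 where "\<And>x. f0 x + r1 * f1 x + r2 * f2 x \<ge> 0"
    "\<And>a b. m1 \<le> a \<Longrightarrow> a \<le> M1 \<Longrightarrow> m2 \<le> b \<Longrightarrow> b \<le> M2 \<Longrightarrow> v + r1 * a + r2 * b \<le> 0"
proof -
  define G where "G = {..<v} \<times> {m1..M1} \<times> {m2..M2}"
  define K where "K = range (\<lambda>x. (f0 x, f1 x, f2 x))"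
  have "convex G" unfolding G_def by (intro convex_Times convex_real_interval)
  moreover have "convex K"
  proof (rule convexI)
    fix p q and s t :: real assume "p \<in> K" "q \<in> K" and st: "s \<ge> 0" "t \<ge> 0"
    then obtain x y where "p = (f0 x, f1 x, f2 x)" "q = (f0 y, f1 y, f2 y)" by (auto simp: K_def)
    with comb[OF st, of x y] show "s *\<^sub>R p + t *\<^sub>R q \<in> K" unfolding K_def by (simp add: image_iff) metis
  qed
  moreover have "(v - 1, m1, m2) \<in> G" using bounds by (simp add: G_def)
  moreover have "G \<inter> K = {}" using lower by (fastforce simp: G_def K_def)
  ultimately obtain r :: "real \<times> real \<times> real" and c where "r \<noteq> 0"
    and rG: "\<forall>p\<in>G. r \<bullet> p \<le> c" and rK: "\<forall>p\<in>K. r \<bullet> p \<ge> c"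
    using separating_hyperplane_sets[of G K] by (force simp: K_def)
  obtain r0 r1 r2 where r: "r = (r0, r1, r2)" by (cases r)
  have K: "r0 * f0 x + r1 * f1 x + r2 * f2 x \<ge> c" for x
    using rK by (auto simp: K_def r algebra_simps)
  have G: "r0 * l + r1 * a + r2 * b \<le> c"
    if "l < v" "m1 \<le> a" "a \<le> M1" "m2 \<le> b" "b \<le> M2" for l a b
    using rG that by (force simp: G_def r algebra_simps)
  \<comment> \<open>On a cone, a linear functional bounded below is nonnegative: scaling by
    \<open>t\<close> would otherwise push it down to \<open>- (\<bar>c\<bar> + 1)\<close>, below
    \<open>c\<close>.\<close>
  have K0: "r0 * f0 x + r1 * f1 x + r2 * f2 x \<ge> 0" for x
  proof (rule ccontr)
    define d where "d = r0 * f0 x + r1 * f1 x + r2 * f2 x"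
    assume "\<not> ?thesis"
    then have d: "d < 0" by (simp add: d_def)
    define t where "t = (\<bar>c\<bar> + 1) / (- d)"
    have "t \<ge> 0" using d by (simp add: t_def divide_nonneg_neg)
    then obtain z where z: "f0 z = t * f0 x" "f1 z = t * f1 x" "f2 z = t * f2 x"
      using comb[of t 0 x x] by auto
    have "c \<le> t * d" using K[of z] by (simp add: z d_def algebra_simps)
    also have "t * d = - (\<bar>c\<bar> + 1)" using d by (simp add: t_def)
    finally show False by linarith
  qed
  obtain o' where "f0 o' = 0" "f1 o' = 0" "f2 o' = 0" using comb[of 0 0 w w] by auto
  then have c: "c \<le> 0" using K[of o'] by simp
  \<comment> \<open>\<open>G\<close> is unbounded towards negative objective values, so a negative
    \<open>r0\<close> would violate the upper bound \<open>c\<close> there.\<close>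
  have r0: "r0 \<ge> 0"
  proof (rule ccontr)
    assume "\<not> ?thesis"
    then have neg: "r0 < 0" by simp
    define k where "k = r1 * m1 + r2 * m2"
    define l where "l = min (v - 1) ((c - k + 1) / r0)"
    have "l \<le> (c - k + 1) / r0" by (simp add: l_def)
    then have "r0 * l \<ge> c - k + 1" using neg by (simp add: field_simps)
    moreover have "l < v" by (simp add: l_def)
    then have "r0 * l + k \<le> c" using G[of l m1 m2] bounds by (simp add: k_def)
    ultimately show False by simp
  qed
  have "r0 \<noteq> 0"
  proof
    assume z: "r0 = 0"
    have K1: "r1 * f1 x + r2 * f2 x \<ge> 0" for x using K0[of x] z by simp
    have G1: "r1 * a + r2 * b \<le> 0" if "m1 \<le> a" "a \<le> M1" "m2 \<le> b" "b \<le> M2" for a b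
      using G[of "v - 1" a b] that z c by simp
    \<comment> \<open>Since \<open>f1 w\<close> is interior, moving it to a suitable endpoint while
      keeping \<open>f2 w\<close> strictly increases the functional from a nonnegative value, yet it
      is at most 0 on the box.\<close>
    have "r1 = 0"
    proof (rule ccontr)
      assume "r1 \<noteq> 0"
      then have "r1 * f1 w < r1 * m1 \<or> r1 * f1 w < r1 * M1"
        using inner by (auto simp: mult_less_cancel_left)
      then show False using G1[of m1 "f2 w"] G1[of M1 "f2 w"] K1[of w] inner bounds by auto
    qed
    then have "r2 \<noteq> 0" using \<open>r \<noteq> 0\<close> z by (auto simp: r zero_prod_def)
    have K2: "r2 * f2 x \<ge> 0" for x using K1[of x] \<open>r1 = 0\<close> by simp
    have G2: "r2 * m2 \<le> 0" "r2 * M2 \<le> 0"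
      using G1[of m1 m2] G1[of m1 M2] \<open>r1 = 0\<close> bounds by auto
    \<comment> \<open>Whatever the sign of \<open>r2\<close>, the Slater condition gives a point
      where \<open>r2 * f2 x\<close> is strictly below its value at some endpoint, hence negative,
      against \<open>K2\<close>.\<close>
    obtain x where "r2 * f2 x < r2 * m2 \<or> r2 * f2 x < r2 * M2"
    proof (cases "m2 < M2")
      case True
      then obtain x where "m2 < f2 x" "f2 x < M2" using slater(1) by blast
      then show thesis using \<open>r2 \<noteq> 0\<close> by (intro that[of x]) (auto simp: mult_less_cancel_left)
    next
      case False
      then obtain x y where "f2 x < m2" "m2 < f2 y" using slater(2) bounds by force
      then show thesis using \<open>r2 \<noteq> 0\<close> that[of x] that[of y]
        by (auto simp: mult_less_cancel_left linorder_neq_iff)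
    qed
    then show False using K2[of x] G2 by linarith
  qed
  with r0 have r0: "r0 > 0" by simp
  show thesis
  proof (rule that[of "r1 / r0" "r2 / r0"])
    show "f0 x + r1 / r0 * f1 x + r2 / r0 * f2 x \<ge> 0" for x
    proof -
      have "f0 x + r1 / r0 * f1 x + r2 / r0 * f2 x = (r0 * f0 x + r1 * f1 x + r2 * f2 x) / r0"
        using r0 by (simp add: field_simps)
      then show ?thesis using K0[of x] r0 by simp
    qed
    show "v + r1 / r0 * a + r2 / r0 * b \<le> 0" if "m1 \<le> a" "a \<le> M1" "m2 \<le> b" "b \<le> M2" for a b
    proof -
      \<comment> \<open>The separation bound holds only for \<open>l < v\<close>; letting
        \<open>l\<close> tend to \<open>v\<close> gives the claim.\<close>
      have "l \<le> - (r1 * a + r2 * b) / r0" if "l < v" for l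
        using G[OF that, of a b] \<open>m1 \<le> a\<close> \<open>a \<le> M1\<close> \<open>m2 \<le> b\<close> \<open>b \<le> M2\<close> c r0 by (simp add: field_simps)
      then have "v \<le> - (r1 * a + r2 * b) / r0" by (rule dense_le)
      then show ?thesis using r0 by (simp add: field_simps)
    qed
  qed
qed

section \<open>Strong duality for the quadratic problem\<close>

lemma quad_form_lagrangian:
  "quad_form (A0 + r1 *\<^sub>R A1 + r2 *\<^sub>R A2) x = quad_form A0 x + r1 * quad_form A1 x + r2 * quad_form A2 x"
  by (simp add: quad_form_add quad_form_scaleR_matrix)

lemma symmetric_matrix_lincomb:
  assumes "symmetric_matrix A0" "symmetric_matrix A1" "symmetric_matrix A2"
  shows "symmetric_matrix (A0 + r1 *\<^sub>R A1 + r2 *\<^sub>R A2)"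
  using assms by (simp add: symmetric_matrix_def transpose_def vec_eq_iff)

theorem theorem12:
  fixes A0 A1 A2 :: "real ^ 'n ^ 'n"
    and m1 M1 m2 M2 :: real
  assumes "CARD('n) \<ge> 3"
    and "symmetric_matrix A0" and "symmetric_matrix A1" and "symmetric_matrix A2"
    and "m1 < M1" and "m2 \<le> M2"
    and "(\<exists>s0 s1 s2 :: real. pos_def (s0 *\<^sub>R A0 + s1 *\<^sub>R A1 + s2 *\<^sub>R A2))
         \<or> dim (span {A0, A1, A2}) < 3"
    and "m2 < M2 \<Longrightarrow>
           \<exists>x. m1 < quad_form A1 x \<and> quad_form A1 x < M1 \<and>
               m2 < quad_form A2 x \<and> quad_form A2 x < M2"
    and "m2 = M2 \<Longrightarrow>
           \<exists>x x'. m1 < quad_form A1 x \<and> quad_form A1 x < M1 \<and> quad_form A2 x < m2 \<and>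
                  m1 < quad_form A1 x' \<and> quad_form A1 x' < M1 \<and> quad_form A2 x' > m2"
  shows "Inf {ereal (quad_form A0 x) | x.
                m1 \<le> quad_form A1 x \<and> quad_form A1 x \<le> M1 \<and>
                m2 \<le> quad_form A2 x \<and> quad_form A2 x \<le> M2}
       = Sup {ereal (l1 * m1 - u1 * M1 + l2 * m2 - u2 * M2) | l1 u1 l2 u2.
                l1 \<ge> 0 \<and> u1 \<ge> 0 \<and> l2 \<ge> 0 \<and> u2 \<ge> 0 \<and>
                pos_semidef (A0 + (u1 - l1) *\<^sub>R A1 + (u2 - l2) *\<^sub>R A2)}"
    (is "Inf ?Pr = Sup ?Du")
proof (rule antisym)
  \<comment> \<open>Weak duality: each constraint is multiplied by its nonnegative multiplier and
    added to the nonnegative Lagrangian form.\<close>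
  show "Sup ?Du \<le> Inf ?Pr"
  proof (intro Sup_least Inf_greatest, clarsimp simp: pos_semidef_def quad_form_lagrangian)
    fix l1 u1 l2 u2 x
    assume nonneg: "0 \<le> l1" "0 \<le> u1" "0 \<le> l2" "0 \<le> u2"
      and psd: "\<forall>x. 0 \<le> quad_form A0 x + (u1 - l1) * quad_form A1 x + (u2 - l2) * quad_form A2 x"
      and feas: "m1 \<le> quad_form A1 x" "quad_form A1 x \<le> M1" "m2 \<le> quad_form A2 x" "quad_form A2 x \<le> M2"
    have "l1 * m1 \<le> l1 * quad_form A1 x" "u1 * quad_form A1 x \<le> u1 * M1"
      "l2 * m2 \<le> l2 * quad_form A2 x" "u2 * quad_form A2 x \<le> u2 * M2"
      using nonneg feas by (auto intro: mult_left_mono)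
    then show "l1 * m1 - u1 * M1 + l2 * m2 - u2 * M2 \<le> quad_form A0 x"
      using psd[rule_format, of x] by (simp add: algebra_simps)
  qed
next
  have comb: "\<exists>z. quad_form A0 z = s * quad_form A0 x + t * quad_form A0 y \<and>
      quad_form A1 z = s * quad_form A1 x + t * quad_form A1 y \<and>
      quad_form A2 z = s * quad_form A2 x + t * quad_form A2 y" if "s \<ge> 0" "t \<ge> 0" for s t x y
    using joint_range_add[OF assms(1-4,7), of "sqrt s *\<^sub>R x" "sqrt t *\<^sub>R y"] that
    by (simp add: quad_form_scaleR)
  obtain w where w: "m1 < quad_form A1 w" "quad_form A1 w < M1" "m2 \<le> quad_form A2 w" "quad_form A2 w \<le> M2"
  proof (cases "m2 < M2")
    case True
    then show thesis using assms(8) that by (meson less_imp_le)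
  next
    case False
    then have eq: "m2 = M2" using assms(6) by simp
    obtain x y where xy: "m1 < quad_form A1 x" "quad_form A1 x < M1" "quad_form A2 x < m2"
      "m1 < quad_form A1 y" "quad_form A1 y < M1" "quad_form A2 y > m2"
      using assms(9)[OF eq] by blast
    \<comment> \<open>The weight at which the convex combination of the two Slater values of
      \<open>A2\<close> equals \<open>m2\<close>; convexity of the joint range realises the
      combination by one vector, with its \<open>A1\<close> value still strictly inside.\<close>
    define t where "t = (m2 - quad_form A2 x) / (quad_form A2 y - quad_form A2 x)"
    have t: "0 \<le> t" "0 \<le> 1 - t" using xy by (auto simp: t_def field_simps)
    have "t * (quad_form A2 y - quad_form A2 x) = m2 - quad_form A2 x" using xy by (simp add: t_def)
    then have A2: "(1 - t) * quad_form A2 x + t * quad_form A2 y = m2" by (simp add: algebra_simps)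
    have "(1 - t) *\<^sub>R quad_form A1 x + t *\<^sub>R quad_form A1 y \<in> {m1<..<M1}"
      by (rule convexD[OF convex_real_interval(8)]) (use xy t in auto)
    moreover obtain z where "quad_form A1 z = (1 - t) * quad_form A1 x + t * quad_form A1 y"
      "quad_form A2 z = m2" using comb[OF t(2,1), of x y] A2 by metis
    ultimately show thesis using eq that[of z] by simp
  qed
  show "Inf ?Pr \<le> Sup ?Du"
  proof (cases "Inf ?Pr")
    case (real v)
    have lower: "v \<le> quad_form A0 x" if "m1 \<le> quad_form A1 x" "quad_form A1 x \<le> M1"
      "m2 \<le> quad_form A2 x" "quad_form A2 x \<le> M2" for x
    proof -
      have "Inf ?Pr \<le> ereal (quad_form A0 x)" by (rule Inf_lower) (use that in blast)
      then show ?thesis by (simp add: real)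
    qed
    have sl: "m2 < M2 \<Longrightarrow> \<exists>x. m2 < quad_form A2 x \<and> quad_form A2 x < M2"
      "m2 = M2 \<Longrightarrow> \<exists>x y. quad_form A2 x < m2 \<and> m2 < quad_form A2 y"
      using assms(8,9) by blast+
    obtain r1 r2 where psd: "\<And>x. quad_form A0 x + r1 * quad_form A1 x + r2 * quad_form A2 x \<ge> 0"
      and box: "\<And>a b. m1 \<le> a \<Longrightarrow> a \<le> M1 \<Longrightarrow> m2 \<le> b \<Longrightarrow> b \<le> M2 \<Longrightarrow> v + r1 * a + r2 * b \<le> 0"
      using multiplier_of_convex_cone[of "quad_form A0" "quad_form A1" "quad_form A2",
          OF comb assms(5,6) w sl lower] by blast
    \<comment> \<open>Negative and positive parts of \<open>r1\<close> and \<open>r2\<close> supply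
      the nonnegative dual variables.\<close>
    let ?l1 = "max (- r1) 0" and ?u1 = "max r1 0" and ?l2 = "max (- r2) 0" and ?u2 = "max r2 0"
    have diff: "?u1 - ?l1 = r1" "?u2 - ?l2 = r2" by auto
    have "pos_semidef (A0 + (?u1 - ?l1) *\<^sub>R A1 + (?u2 - ?l2) *\<^sub>R A2)"
      unfolding diff pos_semidef_def
      using psd symmetric_matrix_lincomb[OF assms(2-4)] by (simp add: quad_form_lagrangian)
    then have "ereal (?l1 * m1 - ?u1 * M1 + ?l2 * m2 - ?u2 * M2) \<in> ?Du"
      by (intro CollectI exI conjI refl) auto
    \<comment> \<open>The dual objective is minus the maximum of \<open>r1 * a + r2 * b\<close> over
      the box, attained at the corner chosen by the signs of \<open>r1\<close> and
      \<open>r2\<close>.\<close>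
    moreover have "v \<le> ?l1 * m1 - ?u1 * M1 + ?l2 * m2 - ?u2 * M2"
      using box[of "if r1 \<ge> 0 then M1 else m1" "if r2 \<ge> 0 then M2 else m2"] assms(5,6)
      by (cases "r1 \<ge> 0"; cases "r2 \<ge> 0") (simp_all add: max_def algebra_simps)
    ultimately show ?thesis unfolding real by (metis (no_types, lifting) Sup_upper2 ereal_less_eq(3))
  next
    case PInf
    have "Inf ?Pr \<le> ereal (quad_form A0 w)" by (rule Inf_lower) (use w in force)
    then show ?thesis using PInf by simp
  qed simp
qed

end
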